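(* Let $\mathcal{F}$ and $\mathcal{G}$ be sets of finite subsets of $\omega$ which are hereditary and spreading. If $\mathcal{F}$ and $\mathcal{G}$ are $\pi$-homeomorphic, i.e. there is a permutation $\pi$ of $\omega$ such that $\mathcal{G} = \{\pi[s] : s\in\mathcal{F}\}$, then $\mathcal{F} = \mathcal{G}$.
   Context: A set $\mathcal{F}$ of finite subsets of $\omega$ is hereditary if it is closed under subsets. For finite $s,t\subseteq\omega$, $t$ is a spread of $s$ if there is an injective map $\sigma: s\to\omega$ with $\sigma(i)\geq i$ for every $i\in s$ and $\sigma[s]=t$. $\mathcal{F}$ is spreading if every spread of every element of $\mathcal{F}$ belongs to $\mathcal{F}$. A permutation of $\omega$ is a bijection $\omega\to\omega$, and $\pi[s]=\{\pi(i): i\in s\}$. *)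

theory Defs
  imports Main
begin

definition hereditary :: "nat set set \<Rightarrow> bool" where
  "hereditary \<F> \<longleftrightarrow> (\<forall>s\<in>\<F>. \<forall>t. t \<subseteq> s \<longrightarrow> t \<in> \<F>)"

(* is_spread_of t s: the set t is a spread of s.  Only the values of \<sigma> on s matter,
   so \<sigma> may be taken to be a total function. *)
definition is_spread_of :: "nat set \<Rightarrow> nat set \<Rightarrow> bool" where
  "is_spread_of t s \<longleftrightarrow>
     (\<exists>\<sigma> :: nat \<Rightarrow> nat. inj_on \<sigma> s \<and> (\<forall>i\<in>s. \<sigma> i \<ge> i) \<and> \<sigma> ` s = t)"

definition spreading :: "nat set set \<Rightarrow> bool" where
  "spreading \<F> \<longleftrightarrow> (\<forall>s\<in>\<F>. \<forall>t. is_spread_of t s \<longrightarrow> t \<in> \<F>)"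

definition pi_homeomorphic :: "nat set set \<Rightarrow> nat set set \<Rightarrow> bool" where
  "pi_homeomorphic \<F> \<G> \<longleftrightarrow> (\<exists>\<pi> :: nat \<Rightarrow> nat. bij \<pi> \<and> \<G> = {\<pi> ` s | s. s \<in> \<F>})"

end

theory Submission
  imports Defs
begin

text \<open>
  Compare points by how freely they may be exchanged: say that \<open>j\<close> can replace \<open>i\<close> in
  \<open>\<F>\<close> if exchanging \<open>i\<close> for \<open>j\<close>, in a member that contains \<open>i\<close> but not \<open>j\<close>, never leads
  out of \<open>\<F>\<close>. This is a preorder that only depends on \<open>\<F>\<close> as a set system, so a homeomorphism \<open>\<pi>\<close> carries it from \<open>\<F>\<close> to \<open>\<G>\<close>.
  For a spreading family it extends the usual order of \<open>\<omega>\<close>; hence the points that cannot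
  replace a given \<open>n\<close> form a finite initial segment of \<open>\<omega>\<close>. The map \<open>\<pi>\<close> sends the initial
  segment of \<open>n\<close> in \<open>\<F>\<close> onto that of \<open>\<pi> n\<close> in \<open>\<G>\<close>. Two initial segments of the same finite
  size are equal, so \<open>\<pi>\<close> maps the segment of \<open>n\<close> onto itself. As \<open>n\<close> lies outside it, so
  does \<open>\<pi> n\<close>: every \<open>n\<close> can be replaced by \<open>\<pi> n\<close> in \<open>\<F>\<close> (\<open>replaceable_by_homeomorphism\<close>).

  Since the members of \<open>\<F>\<close> are finite, such replacements can be made one point at a
  time until \<open>s\<close> has become \<open>\<pi>[s]\<close> (\<open>image_mem_if_replaceable\<close>). This gives
  \<open>\<G> \<subseteq> \<F>\<close>, and the other inclusion follows by using the inverse of \<open>\<pi>\<close>.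
\<close>

definition replaceable :: "'a set set \<Rightarrow> 'a \<Rightarrow> 'a \<Rightarrow> bool" where
  "replaceable \<F> i j \<longleftrightarrow> (\<forall>s\<in>\<F>. i \<in> s \<longrightarrow> j \<notin> s \<longrightarrow> insert j (s - {i}) \<in> \<F>)"

lemma replaceableD:
  "replaceable \<F> i j \<Longrightarrow> s \<in> \<F> \<Longrightarrow> i \<in> s \<Longrightarrow> j \<notin> s \<Longrightarrow> insert j (s - {i}) \<in> \<F>"
  by (simp add: replaceable_def)

lemma replaceable_refl: "replaceable \<F> i i"
  by (simp add: replaceable_def)

lemma replaceable_trans:
  assumes ij: "replaceable \<F> i j" and jk: "replaceable \<F> j k"
  shows "replaceable \<F> i k"
  unfolding replaceable_def
proof (intro ballI impI)
  fix s assume s: "s \<in> \<F>" "i \<in> s" "k \<notin> s"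
  show "insert k (s - {i}) \<in> \<F>"
  proof (cases "j \<in> s")
    case False
    have "insert j (s - {i}) \<in> \<F>"
      using ij s(1,2) False by (rule replaceableD)
    moreover have "k \<noteq> j \<Longrightarrow> k \<notin> insert j (s - {i})"
      using s(3) by simp
    moreover have "insert k (insert j (s - {i}) - {j}) = insert k (s - {i})"
      using False by auto
    ultimately show ?thesis
      using replaceableD[OF jk, of "insert j (s - {i})"] by (cases "k = j") auto
  next
    case True
    show ?thesis
    proof (cases "i = j")
      case True
      then show ?thesis using jk s by (simp add: replaceableD)
    next
      case False
      \<comment> \<open>With \<open>j\<close> already present, its place must be vacated first: \<open>j\<close> moves to \<open>k\<close>,
        then \<open>i\<close> moves to \<open>j\<close>.\<close>
      have "insert k (s - {j}) \<in> \<F>"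
        using jk s(1) True s(3) by (rule replaceableD)
      moreover have "i \<in> insert k (s - {j})" "j \<notin> insert k (s - {j})"
        using False True s by auto
      ultimately have "insert j (insert k (s - {j}) - {i}) \<in> \<F>"
        by (rule replaceableD[OF ij])
      moreover have "insert j (insert k (s - {j}) - {i}) = insert k (s - {i})"
        using True False s by auto
      ultimately show ?thesis by simp
    qed
  qed
qed

lemma replaceable_image_iff:
  assumes "inj \<pi>"
  shows "replaceable ((`) \<pi> ` \<F>) (\<pi> i) (\<pi> j) \<longleftrightarrow> replaceable \<F> i j"
proof -
  have eq: "insert (\<pi> j) (\<pi> ` s - {\<pi> i}) = \<pi> ` insert j (s - {i})" for s
    using assms by (simp add: image_set_diff)
  have mem: "\<pi> ` s \<in> (`) \<pi> ` \<F> \<longleftrightarrow> s \<in> \<F>" for s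
    using assms by (auto simp: inj_image_eq_iff)
  show ?thesis
    unfolding replaceable_def ball_simps
    by (simp only: eq mem inj_image_mem_iff[OF assms])
qed

lemma spreading_replaceable:
  assumes "spreading \<F>" and "i \<le> j"
  shows "replaceable \<F> i j"
  unfolding replaceable_def
proof (intro ballI impI)
  fix s assume s: "s \<in> \<F>" "i \<in> s" "j \<notin> s"
  have "is_spread_of (insert j (s - {i})) s"
    unfolding is_spread_of_def
  proof (intro exI conjI)
    show "inj_on (id(i := j)) s"
      using s by (auto simp: inj_on_def)
    show "\<forall>k\<in>s. k \<le> (id(i := j)) k"
      using assms(2) by simp
    show "id(i := j) ` s = insert j (s - {i})"
      using s by (auto simp: image_iff)
  qed
  then show "insert j (s - {i}) \<in> \<F>"
    using assms(1) s(1) by (auto simp: spreading_def)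
qed

text \<open>
  The points of \<open>s\<close> are moved one at a time. While \<open>\<sigma>[s] \<noteq> s\<close>, finiteness and injectivity
  provide a point \<open>i\<close> of \<open>s\<close> whose image is unoccupied. After \<open>i\<close> has moved there, it is
  declared a fixed point of the map. The induction counts the points that are not fixed;
  the size of \<open>\<sigma>[s] - s\<close> would not do, because the vacated \<open>i\<close> may itself lie in \<open>\<sigma>[s]\<close>.
\<close>
lemma image_mem_if_replaceable:
  assumes "s \<in> \<F>" "finite s" "inj_on \<sigma> s" "\<And>i. i \<in> s \<Longrightarrow> replaceable \<F> i (\<sigma> i)"
  shows "\<sigma> ` s \<in> \<F>"
  using assms
proof (induction "card {k \<in> s. \<sigma> k \<noteq> k}" arbitrary: s \<sigma> rule: less_induct)
  case less
  show ?case
  proof (cases "\<sigma> ` s \<subseteq> s")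
    case True
    then have "\<sigma> ` s = s"
      using less.prems by (simp add: endo_inj_surj)
    then show ?thesis using less.prems by simp
  next
    case False
    then obtain i where i: "i \<in> s" "\<sigma> i \<notin> s" by auto
    define s' where "s' = insert (\<sigma> i) (s - {i})"
    define \<tau> where "\<tau> = \<sigma>(\<sigma> i := \<sigma> i)"
    have eq: "\<tau> k = \<sigma> k" if "k \<in> s - {i}" for k
      using that i by (auto simp: \<tau>_def)
    have eq_i: "\<tau> (\<sigma> i) = \<sigma> i" by (simp add: \<tau>_def)
    have img: "\<tau> ` s' = \<sigma> ` s"
    proof -
      have "\<tau> ` (s - {i}) = \<sigma> ` (s - {i})"
        using eq by (rule image_cong[OF refl])
      then have "\<tau> ` s' = insert (\<sigma> i) (\<sigma> ` (s - {i}))"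
        using eq_i by (simp add: s'_def)
      also have "\<dots> = \<sigma> ` s" using i by blast
      finally show ?thesis .
    qed
    have "s' \<in> \<F>"
      unfolding s'_def using less.prems(4)[OF i(1)] less.prems(1) i by (rule replaceableD)
    moreover have "finite s'"
      using less.prems by (simp add: s'_def)
    moreover have "inj_on \<tau> s'"
    proof (rule eq_card_imp_inj_on)
      have "card s' = card s"
        using i less.prems(2) card_Suc_Diff1[of s i] by (simp only: s'_def) simp
      then show "card (\<tau> ` s') = card s'"
        using less.prems(3) by (simp add: img card_image)
    qed fact
    moreover have "replaceable \<F> k (\<tau> k)" if "k \<in> s'" for k
      using that less.prems(4) eq eq_i by (auto simp: s'_def replaceable_refl)
    moreover have "card {k \<in> s'. \<tau> k \<noteq> k} < card {k \<in> s. \<sigma> k \<noteq> k}"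
    proof (rule psubset_card_mono)
      show "finite {k \<in> s. \<sigma> k \<noteq> k}" using less.prems by simp
      have "i \<in> {k \<in> s. \<sigma> k \<noteq> k}" "i \<notin> s'" using i by (auto simp: s'_def)
      then show "{k \<in> s'. \<tau> k \<noteq> k} \<subset> {k \<in> s. \<sigma> k \<noteq> k}"
        using eq eq_i by (auto simp: s'_def)
    qed
    ultimately have "\<tau> ` s' \<in> \<F>" using less.hyps by blast
    then show ?thesis by (simp add: img)
  qed
qed

lemma not_replaceable_eq_lessThan:
  assumes "spreading \<F>"
  shows "{m. \<not> replaceable \<F> n m} = {..<card {m. \<not> replaceable \<F> n m}}"
proof -
  let ?A = "{m. \<not> replaceable \<F> n m}"
  have down: "m' \<in> ?A" if "m \<in> ?A" "m' \<le> m" for m m'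
    using that spreading_replaceable[OF assms, of m' m] by (auto dest: replaceable_trans)
  define b where "b = (LEAST m. m \<notin> ?A)"
  have "b \<notin> ?A"
    unfolding b_def by (rule LeastI[of _ n]) (simp add: replaceable_refl)
  have "?A = {..<b}"
  proof (intro set_eqI iffI)
    show "m \<in> {..<b}" if "m \<in> ?A" for m
      using \<open>b \<notin> ?A\<close> down[OF that, of b] by (meson lessThan_iff not_le)
    show "m \<in> ?A" if "m \<in> {..<b}" for m
      using that not_less_Least[of m "\<lambda>m. m \<notin> ?A"] unfolding b_def by blast
  qed
  then show ?thesis by simp
qed

lemma replaceable_by_homeomorphism:
  assumes F: "spreading \<F>" and G: "spreading ((`) \<pi> ` \<F>)" and \<pi>: "bij \<pi>"
  shows "replaceable \<F> n (\<pi> n)"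
proof (rule ccontr)
  assume neg: "\<not> replaceable \<F> n (\<pi> n)"
  let ?A = "{m. \<not> replaceable \<F> n m}"
  let ?B = "{m. \<not> replaceable ((`) \<pi> ` \<F>) (\<pi> n) m}"
  have inj: "inj \<pi>" using \<pi> by (rule bij_is_inj)
  have "\<pi> ` ?A = ?B"
  proof (intro set_eqI iffI)
    show "m \<in> ?B" if "m \<in> \<pi> ` ?A" for m
      using that replaceable_image_iff[OF inj, of \<F> n] by auto
    show "m \<in> \<pi> ` ?A" if "m \<in> ?B" for m
    proof -
      obtain k where "m = \<pi> k" using surjD[OF bij_is_surj[OF \<pi>]] by blast
      with that show ?thesis
        using replaceable_image_iff[OF inj, of \<F> n k] by blast
    qed
  qed
  then have card: "card ?B = card ?A"
    using card_image[OF inj_on_subset[OF inj subset_UNIV]] by metis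
  have "?B = {..<card ?B}" by (rule not_replaceable_eq_lessThan[OF G])
  also have "\<dots> = {..<card ?A}" by (simp only: card)
  also have "\<dots> = ?A" by (rule not_replaceable_eq_lessThan[OF F, symmetric])
  finally have "?B = ?A" .
  moreover have "\<pi> n \<notin> ?B" by (simp add: replaceable_refl)
  ultimately show False using neg by blast
qed

lemma spreading_image_subset:
  assumes "spreading \<F>" "spreading ((`) \<pi> ` \<F>)" "bij \<pi>" "\<forall>s\<in>\<F>. finite s"
  shows "(`) \<pi> ` \<F> \<subseteq> \<F>"
proof (rule image_subsetI)
  fix s assume "s \<in> \<F>"
  then show "\<pi> ` s \<in> \<F>"
    using assms
    by (intro image_mem_if_replaceable replaceable_by_homeomorphism)
      (auto intro: inj_on_subset[OF bij_is_inj])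
qed

theorem theorem13:
  fixes \<F> \<G> :: "nat set set"
  assumes "\<forall>s\<in>\<F>. finite s" and "\<forall>s\<in>\<G>. finite s"
    and "hereditary \<F>" and "hereditary \<G>"
    and "spreading \<F>" and "spreading \<G>"
    and "pi_homeomorphic \<F> \<G>"
  shows "\<F> = \<G>"
proof -
  obtain \<pi> where \<pi>: "bij \<pi>" and G: "\<G> = (`) \<pi> ` \<F>"
    using assms(7) by (auto simp: pi_homeomorphic_def image_def)
  have F: "\<F> = (`) (inv \<pi>) ` \<G>"
    by (simp add: G image_image inv_f_f[OF bij_is_inj[OF \<pi>]])
  have "\<G> \<subseteq> \<F>"
    using spreading_image_subset[of \<F> \<pi>] assms(1,5,6) \<pi> by (simp add: G)
  moreover have "\<F> \<subseteq> \<G>"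
    using spreading_image_subset[of \<G> "inv \<pi>"] assms(2,5,6) bij_imp_bij_inv[OF \<pi>]
    by (simp add: F[symmetric])
  ultimately show ?thesis by simp
qed

end
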